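(* Let $T_0$ be a triangle with medial triangle $T$, and let $\mathcal{Y}$ be the Yff hyperbola of $T_0$. Then, in terms of the triangle $T$, the conic $\mathcal{Y}$ has its vertices at the centroid and at the de Longchamps point of $T$, and has a focus at the orthocenter of $T$. The directrix of $\mathcal{Y}$ (corresponding to this focus) is perpendicular to the Euler line of $T$ and passes through the circumcenter of $T$.
   Context: The medial triangle of a triangle is the triangle whose vertices are the midpoints of its sides. The Yff hyperbola of a (non-equilateral) triangle is the hyperbola whose two vertices are the centroid and the orthocenter of the triangle and which has a focus at the circumcenter. The de Longchamps point of a triangle is the reflection of its orthocenter in its circumcenter. *)

theory Defs
  imports "HOL-Analysis.Analysis"
begin

type_synonym point = "real ^ 2"
type_synonym triangle = "point \<times> point \<times> point"

fun nondegenerate :: "triangle \<Rightarrow> bool" where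
  "nondegenerate (A, B, C) \<longleftrightarrow> \<not> collinear {A, B, C}"

fun equilateral :: "triangle \<Rightarrow> bool" where
  "equilateral (A, B, C) \<longleftrightarrow> dist A B = dist B C \<and> dist B C = dist C A"

fun medial_triangle :: "triangle \<Rightarrow> triangle" where
  "medial_triangle (A, B, C) = (midpoint B C, midpoint C A, midpoint A B)"

fun centroid :: "triangle \<Rightarrow> point" where
  "centroid (A, B, C) = (1/3) *\<^sub>R (A + B + C)"

fun circumcenter :: "triangle \<Rightarrow> point" where
  "circumcenter (A, B, C) = (THE P. dist P A = dist P B \<and> dist P B = dist P C)"

text \<open>The common point of the three altitudes.\<close>

fun orthocenter :: "triangle \<Rightarrow> point" where
  "orthocenter (A, B, C) =
     (THE P. orthogonal (P - A) (B - C) \<and> orthogonal (P - B) (C - A) \<and> orthogonal (P - C) (A - B))"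

definition de_longchamps_point :: "triangle \<Rightarrow> point" where
  "de_longchamps_point T = 2 *\<^sub>R circumcenter T - orthocenter T"

text \<open>This is a line only when the circumcenter and the orthocenter differ, that is, for
  non-equilateral triangles.\<close>

definition euler_line :: "triangle \<Rightarrow> point set" where
  "euler_line T = affine hull {circumcenter T, orthocenter T}"

definition is_line :: "point set \<Rightarrow> bool" where
  "is_line L \<longleftrightarrow> (\<exists>P Q. P \<noteq> Q \<and> L = affine hull {P, Q})"

definition perpendicular :: "point set \<Rightarrow> point set \<Rightarrow> bool" where
  "perpendicular L M \<longleftrightarrow> is_line L \<and> is_line M \<and>
     (\<forall>P\<in>L. \<forall>Q\<in>L. \<forall>R\<in>M. \<forall>S\<in>M. orthogonal (P - Q) (R - S))"

text \<open>Hyperbolas are point sets (both branches). The bounds on \<open>a\<close> exclude the degenerate loci: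
  the perpendicular bisector of the foci, a pair of rays, and the empty set.\<close>

definition hyperbola_with_foci :: "point set \<Rightarrow> point \<Rightarrow> point \<Rightarrow> bool" where
  "hyperbola_with_foci Y F F' \<longleftrightarrow>
     (\<exists>a>0. 2 * a < dist F F' \<and> Y = {P. \<bar>dist P F - dist P F'\<bar> = 2 * a})"

definition is_focus :: "point set \<Rightarrow> point \<Rightarrow> bool" where
  "is_focus Y F \<longleftrightarrow> (\<exists>F'. hyperbola_with_foci Y F F')"

text \<open>The vertices are the points where the hyperbola meets its transverse axis, the line
  through the foci.\<close>

definition hyperbola_vertices :: "point set \<Rightarrow> point set" where
  "hyperbola_vertices Y = {V \<in> Y. \<exists>F F'. hyperbola_with_foci Y F F' \<and> V \<in> affine hull {F, F'}}"

text \<open>The focus-directrix property, with eccentricity \<open>e > 1\<close> as for every hyperbola.\<close>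

definition is_directrix :: "point set \<Rightarrow> point \<Rightarrow> point set \<Rightarrow> bool" where
  "is_directrix Y F D \<longleftrightarrow>
     is_line D \<and> F \<notin> D \<and> (\<exists>e>1. Y = {P. dist P F = e * infdist P D})"

text \<open>For a nondegenerate non-equilateral triangle exactly one point set fits the description: the
  vertices determine the center and the semi-axis, and reflecting the given focus in the center
  gives the other one.\<close>

definition yff_hyperbola :: "triangle \<Rightarrow> point set" where
  "yff_hyperbola T = (THE Y. hyperbola_vertices Y = {centroid T, orthocenter T} \<and>
                             is_focus Y (circumcenter T))"

end

(* Let P and G be the circumcenter and the centroid of the given triangle, and u = G - P. By Euler's
   relation the orthocenter is P + 3u, so the Yff hyperbola has center P + 2u, semi-axis |u|,
   foci P and P + 4u and eccentricity 2, and the directrix for P passes through P + (3/2)u.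
   Passing to the medial triangle keeps the centroid, turns P into the orthocenter, P + (3/2)u into
   the circumcenter, and hence P + 3u into the de Longchamps point.

   Vertices and directrices are properties of the bare point set, so one has to recover the
   parameters from it: the center is its only center of symmetry, and the vertices are its points
   closest to the center. *)

theory Submission imports Defs begin

section \<open>Hyperbolas in centered form: equation and vertices\<close>

text \<open>The parameters are the center \<open>m\<close>, half the vector between the foci
  \<open>u\<close> and the semi-axis \<open>a\<close>; the bounds \<open>0 < a\<close> and
  \<open>a < norm u\<close> are left to the lemmas.\<close>

definition hyperbola :: "'a::real_inner \<Rightarrow> 'a \<Rightarrow> real \<Rightarrow> 'a set" where
  "hyperbola m u a = {P. \<bar>dist P (m - u) - dist P (m + u)\<bar> = 2 * a}"

lemma norm_less_imp_square_less:
  fixes u :: "'a::real_inner"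
  assumes "0 < a" "a < norm u"
  shows "a\<^sup>2 < u \<bullet> u"
  using assms by (simp add: power_strict_mono flip: power2_norm_eq_inner)

text \<open>This is the standard equation in vector form: with coordinate X along \<open>u\<close>,
  Y across it and b^2 = \<open>u \<bullet> u - a\<^sup>2\<close>, the right side reads X^2/a^2 -
  Y^2/b^2 = 1.\<close>

lemma dist_difference_iff:
  fixes x u :: "'a::real_inner"
  assumes "0 < a" "a < norm u"
  shows "\<bar>norm (x + u) - norm (x - u)\<bar> = 2 * a \<longleftrightarrow>
    (x \<bullet> u)\<^sup>2 - a\<^sup>2 * (x \<bullet> x) = a\<^sup>2 * (u \<bullet> u - a\<^sup>2)"
proof -
  define r s where "r = norm (x + u)" and "s = norm (x - u)"
  have r2: "r\<^sup>2 = x \<bullet> x + 2 * (x \<bullet> u) + u \<bullet> u" and s2: "s\<^sup>2 = x \<bullet> x - 2 * (x \<bullet> u) + u \<bullet> u"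
    by (simp_all add: r_def s_def power2_norm_eq_inner inner_simps inner_commute)
  have "norm (x + u - (x - u)) \<le> r + s"
    unfolding r_def s_def by (rule norm_triangle_ineq4)
  moreover have "x + u - (x - u) = 2 *\<^sub>R u" by (simp add: scaleR_2)
  ultimately have "2 * norm u \<le> r + s" by simp
  then have "2 * a < r + s" using assms by simp
  then have ne: "(r + s)\<^sup>2 - 4 * a\<^sup>2 \<noteq> 0"
    using assms power_strict_mono[of "2 * a" "r + s" 2] by (simp add: power_mult_distrib)
  have "\<bar>r - s\<bar> = 2 * a \<longleftrightarrow> (r - s)\<^sup>2 = (2 * a)\<^sup>2"
    using assms power2_eq_iff_nonneg[of "\<bar>r - s\<bar>" "2 * a"] by simp
  \<comment> \<open>The extra factor is nonzero because \<open>r + s > 2 * a\<close>. The product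
    depends on \<open>r\<^sup>2\<close> and \<open>s\<^sup>2\<close> only, so all square roots
    disappear.\<close>
  also have "\<dots> \<longleftrightarrow> ((r - s)\<^sup>2 - 4 * a\<^sup>2) * ((r + s)\<^sup>2 - 4 * a\<^sup>2) = 0"
    using ne by (simp add: power_mult_distrib)
  also have "((r - s)\<^sup>2 - 4 * a\<^sup>2) * ((r + s)\<^sup>2 - 4 * a\<^sup>2) =
      (r\<^sup>2 - s\<^sup>2)\<^sup>2 - 8 * a\<^sup>2 * (r\<^sup>2 + s\<^sup>2) + 16 * a\<^sup>2 * a\<^sup>2"
    by (simp add: power2_eq_square algebra_simps)
  also have "\<dots> = 16 * ((x \<bullet> u)\<^sup>2 - a\<^sup>2 * (x \<bullet> x) - a\<^sup>2 * (u \<bullet> u - a\<^sup>2))"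
    unfolding r2 s2 by (simp add: power2_eq_square algebra_simps)
  finally show ?thesis unfolding r_def s_def by argo
qed

lemma mem_hyperbola_iff:
  assumes "0 < a" "a < norm u"
  shows "P \<in> hyperbola m u a \<longleftrightarrow>
    ((P - m) \<bullet> u)\<^sup>2 - a\<^sup>2 * ((P - m) \<bullet> (P - m)) = a\<^sup>2 * (u \<bullet> u - a\<^sup>2)"
  using dist_difference_iff[OF assms, of "P - m"]
  by (simp add: hyperbola_def dist_norm algebra_simps)

lemma hyperbola_axis_iff:
  assumes "0 < a" "a < norm u"
  shows "m + s *\<^sub>R u \<in> hyperbola m u a \<longleftrightarrow> s\<^sup>2 * (u \<bullet> u) = a\<^sup>2"
proof -
  have pos: "u \<bullet> u - a\<^sup>2 \<noteq> 0" using norm_less_imp_square_less[OF assms] by simp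
  have "m + s *\<^sub>R u \<in> hyperbola m u a \<longleftrightarrow>
      (s\<^sup>2 * (u \<bullet> u)) * (u \<bullet> u - a\<^sup>2) = a\<^sup>2 * (u \<bullet> u - a\<^sup>2)"
    unfolding mem_hyperbola_iff[OF assms] by (simp add: power2_eq_square algebra_simps)
  then show ?thesis using pos by simp
qed

lemma hyperbola_vertex:
  assumes "0 < a" "a < norm u"
  shows "m + (a / norm u) *\<^sub>R u \<in> hyperbola m u a"
    and "m - (a / norm u) *\<^sub>R u \<in> hyperbola m u a"
proof -
  have "norm u \<noteq> 0" using assms by auto
  then have "(a / norm u)\<^sup>2 * (u \<bullet> u) = a\<^sup>2"
    by (simp add: power_divide flip: power2_norm_eq_inner)
  then show "m + (a / norm u) *\<^sub>R u \<in> hyperbola m u a"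
    "m - (a / norm u) *\<^sub>R u \<in> hyperbola m u a"
    using hyperbola_axis_iff[OF assms, of m "a / norm u"]
      hyperbola_axis_iff[OF assms, of m "- (a / norm u)"] by simp_all
qed

text \<open>Bounding \<open>((P - m) \<bullet> u)\<^sup>2\<close> by Cauchy-Schwarz in the equation
  leaves a common positive factor \<open>u \<bullet> u - a\<^sup>2\<close> to cancel.\<close>

lemma hyperbola_norm_ge:
  assumes "0 < a" "a < norm u" "P \<in> hyperbola m u a"
  shows "a \<le> norm (P - m)"
proof -
  have pos: "0 < u \<bullet> u - a\<^sup>2" using norm_less_imp_square_less[OF assms(1,2)] by simp
  have "a\<^sup>2 * (u \<bullet> u - a\<^sup>2) = ((P - m) \<bullet> u)\<^sup>2 - a\<^sup>2 * ((P - m) \<bullet> (P - m))"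
    using mem_hyperbola_iff[OF assms(1,2)] assms(3) by metis
  also have "\<dots> \<le> ((P - m) \<bullet> (P - m)) * (u \<bullet> u - a\<^sup>2)"
    using Cauchy_Schwarz_ineq[of "P - m" u] by (simp add: algebra_simps)
  finally have "a\<^sup>2 \<le> (norm (P - m))\<^sup>2"
    using pos by (simp add: power2_norm_eq_inner)
  then show ?thesis using power2_le_imp_le by fastforce
qed

text \<open>Distance \<open>a\<close> from the center is the equality case of Cauchy-Schwarz, which
  forces \<open>P - m\<close> to be parallel to \<open>u\<close>. This describes the vertices
  without mentioning foci.\<close>

lemma hyperbola_norm_eq_iff:
  assumes "0 < a" "a < norm u" "P \<in> hyperbola m u a"
  shows "norm (P - m) = a \<longleftrightarrow> P \<in> {m - (a / norm u) *\<^sub>R u, m + (a / norm u) *\<^sub>R u}"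
proof
  assume n: "norm (P - m) = a"
  have u: "norm u \<noteq> 0" using assms by auto
  have "((P - m) \<bullet> u)\<^sup>2 = (norm (P - m) * norm u)\<^sup>2"
    using mem_hyperbola_iff[OF assms(1,2)] assms(3) n
    by (simp add: power2_norm_eq_inner[symmetric] power_mult_distrib algebra_simps)
  then have "\<bar>(P - m) \<bullet> u\<bar> = norm (P - m) * norm u"
    by (smt (verit) norm_ge_zero power2_eq_iff zero_le_mult_iff)
  then have "a *\<^sub>R u = norm u *\<^sub>R (P - m) \<or> a *\<^sub>R u = - norm u *\<^sub>R (P - m)"
    using norm_cauchy_schwarz_abs_eq[of "P - m" u] n by simp
  then have "(1 / norm u) *\<^sub>R (a *\<^sub>R u) = P - m \<or> (1 / norm u) *\<^sub>R (a *\<^sub>R u) = - (P - m)"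
    using u by (elim disjE) (simp_all del: scaleR_scaleR add: scaleR_scaleR[of "1 / norm u" "norm u"])
  then show "P \<in> {m - (a / norm u) *\<^sub>R u, m + (a / norm u) *\<^sub>R u}"
    by (auto simp: algebra_simps)
next
  assume "P \<in> {m - (a / norm u) *\<^sub>R u, m + (a / norm u) *\<^sub>R u}"
  then show "norm (P - m) = a" using assms by auto
qed

section \<open>Recovering center and semi-axis from the point set\<close>

lemma hyperbola_point_reflection:
  "P \<in> hyperbola m u a \<Longrightarrow> 2 *\<^sub>R m - P \<in> hyperbola m u a"
proof -
  have "2 *\<^sub>R m - P - (m - u) = m + u - P" "2 *\<^sub>R m - P - (m + u) = m - u - P"
    by (simp_all add: scaleR_2 algebra_simps)
  \<comment> \<open>The reflection in the center swaps the foci, and so the two distances.\<close>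
  then have "dist (2 *\<^sub>R m - P) (m - u) = dist P (m + u)"
    "dist (2 *\<^sub>R m - P) (m + u) = dist P (m - u)"
    unfolding dist_norm by (simp_all only: norm_minus_commute)
  then show "P \<in> hyperbola m u a \<Longrightarrow> ?thesis" by (simp add: hyperbola_def)
qed

text \<open>Two centers of symmetry would make the hyperbola invariant under a translation.\<close>

lemma hyperbola_center_unique:
  assumes ua: "0 < a" "a < norm u" and eq: "hyperbola m u a = hyperbola m' u' a'"
  shows "m = m'"
proof -
  \<comment> \<open>Reflecting in \<open>m\<close> and then in \<open>m'\<close> is the translation
    by \<open>t\<close>.\<close>
  define t where "t = 2 *\<^sub>R (m' - m)"
  have shift: "P + t \<in> hyperbola m u a" if "P \<in> hyperbola m u a" for P
  proof -
    have "2 *\<^sub>R m' - (2 *\<^sub>R m - P) \<in> hyperbola m u a"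
      using that hyperbola_point_reflection eq by metis
    moreover have "2 *\<^sub>R m' - (2 *\<^sub>R m - P) = P + t" by (simp add: t_def algebra_simps)
    ultimately show ?thesis by simp
  qed
  define k where "k = a / norm u"
  have k: "k \<noteq> 0" using ua by (auto simp: k_def)
  have pos: "u \<bullet> u - a\<^sup>2 \<noteq> 0" using norm_less_imp_square_less[OF ua] by simp
  have base: "(k * (u \<bullet> u))\<^sup>2 - a\<^sup>2 * (k * (k * (u \<bullet> u))) = a\<^sup>2 * (u \<bullet> u - a\<^sup>2)"
    using hyperbola_vertex(1)[OF ua, of m] unfolding mem_hyperbola_iff[OF ua] k_def[symmetric] by simp
  have 1: "(k * (u \<bullet> u) + t \<bullet> u)\<^sup>2 - a\<^sup>2 * ((k *\<^sub>R u + t) \<bullet> (k *\<^sub>R u + t)) = a\<^sup>2 * (u \<bullet> u - a\<^sup>2)"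
    using shift[OF hyperbola_vertex(1)[OF ua]] unfolding mem_hyperbola_iff[OF ua] k_def[symmetric]
    by (simp add: inner_add_left)
  have 2: "(- k * (u \<bullet> u) + t \<bullet> u)\<^sup>2 - a\<^sup>2 * ((- k *\<^sub>R u + t) \<bullet> (- k *\<^sub>R u + t)) = a\<^sup>2 * (u \<bullet> u - a\<^sup>2)"
    using shift[OF hyperbola_vertex(2)[OF ua]] unfolding mem_hyperbola_iff[OF ua] k_def[symmetric]
    by (simp add: inner_add_left inner_diff_left inner_diff_right)
  \<comment> \<open>Both vertices \<open>m + k *\<^sub>R u\<close> and
    \<open>m - k *\<^sub>R u\<close> stay on the hyperbola when shifted by \<open>t\<close>. In the
    difference of their equations only the terms odd in \<open>k\<close> survive, which gives
    \<open>t \<bullet> u = 0\<close>.\<close>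
  have "4 * k * (t \<bullet> u) * (u \<bullet> u - a\<^sup>2) =
      ((k * (u \<bullet> u) + t \<bullet> u)\<^sup>2 - a\<^sup>2 * ((k *\<^sub>R u + t) \<bullet> (k *\<^sub>R u + t))) -
      ((- k * (u \<bullet> u) + t \<bullet> u)\<^sup>2 - a\<^sup>2 * ((- k *\<^sub>R u + t) \<bullet> (- k *\<^sub>R u + t)))"
    by (simp add: inner_simps inner_commute[of u t] power2_eq_square algebra_simps)
  also have "\<dots> = 0" unfolding 1 2 by simp
  finally have "4 * k * (t \<bullet> u) * (u \<bullet> u - a\<^sup>2) = 0" .
  then have tu: "t \<bullet> u = 0" using k pos by simp
  \<comment> \<open>Once \<open>t\<close> is orthogonal to \<open>u\<close>, the equations at the
    vertex and at the shifted vertex differ by this term only.\<close>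
  have "a\<^sup>2 * (t \<bullet> t) = 0"
    using 1 base tu by (simp add: inner_simps inner_commute[of u t] power2_eq_square algebra_simps)
  then show ?thesis using ua by (simp add: t_def)
qed

text \<open>The centers agree, and each semi-axis is the least distance from the center, so the
  semi-axes agree as well. The vertices are the points at that distance.\<close>

lemma hyperbola_same_vertices:
  assumes ua: "0 < a" "a < norm u" and ua': "0 < a'" "a' < norm u'"
    and eq: "hyperbola m u a = hyperbola m' u' a'"
  shows "{m - (a / norm u) *\<^sub>R u, m + (a / norm u) *\<^sub>R u} =
         {m' - (a' / norm u') *\<^sub>R u', m' + (a' / norm u') *\<^sub>R u'}"
proof -
  have m: "m' = m" using hyperbola_center_unique[OF ua eq] by simp
  have v: "{m - (b / norm w) *\<^sub>R w, m + (b / norm w) *\<^sub>R w} = {P \<in> hyperbola m w b. norm (P - m) = b}"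
    if "0 < b" "b < norm w" for w b
    using hyperbola_vertex[OF that] hyperbola_norm_eq_iff[OF that] by blast
  have "a \<le> a'"
    using hyperbola_norm_ge[OF ua] hyperbola_vertex(1)[OF ua'] hyperbola_norm_eq_iff[OF ua'] eq m
    by (metis insertCI)
  moreover have "a' \<le> a"
    using hyperbola_norm_ge[OF ua'] hyperbola_vertex(1)[OF ua] hyperbola_norm_eq_iff[OF ua] eq m
    by (metis insertCI)
  ultimately have "a = a'" by simp
  then show ?thesis using v[OF ua] v[OF ua'] m eq by simp
qed

section \<open>Foci and vertices of the bare point set\<close>

lemma hyperbola_with_foci_iff:
  "hyperbola_with_foci Y (m - u) (m + u) \<longleftrightarrow> (\<exists>a>0. a < norm u \<and> Y = hyperbola m u a)"
proof -
  have "dist (m - u) (m + u) = 2 * norm u"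
    by (simp add: dist_norm scaleR_2[symmetric] norm_minus_commute[of "m - u"])
  then show ?thesis by (simp add: hyperbola_with_foci_def hyperbola_def)
qed

lemma obtain_center:
  obtains m u :: "'a::real_vector" where "F = m - u" "F' = m + u"
proof
  show "F = midpoint F F' - (1/2) *\<^sub>R (F' - F)" "F' = midpoint F F' + (1/2) *\<^sub>R (F' - F)"
    by (simp_all add: midpoint_def algebra_simps flip: scaleR_add_left)
qed

lemma is_focus_iff:
  "is_focus Y F \<longleftrightarrow> (\<exists>m u a. 0 < a \<and> a < norm u \<and> F = m - u \<and> Y = hyperbola m u a)"
  unfolding is_focus_def using hyperbola_with_foci_iff by (metis obtain_center)

text \<open>Any pair of foci of the set may witness a vertex in \<open>hyperbola_vertices\<close>. A
  witness with center \<open>n\<close> and semi-axis \<open>b\<close> puts the point at distance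
  \<open>b\<close> from \<open>n\<close>, and \<open>hyperbola_same_vertices\<close> carries it over
  to the given parameters.\<close>

lemma hyperbola_vertices_hyperbola:
  assumes "0 < a" "a < norm u"
  shows "hyperbola_vertices (hyperbola m u a) = {m - (a / norm u) *\<^sub>R u, m + (a / norm u) *\<^sub>R u}"
    (is "_ = ?V m u a")
proof
  have axis: "affine hull {m - u, m + u} = range (\<lambda>s. m + s *\<^sub>R u)" for m u :: point
  proof -
    \<comment> \<open>The hull is parametrized from one focus with step
      \<open>2 *\<^sub>R u\<close>; the substitution \<open>2 * s - 1\<close> moves the origin to
      the center.\<close>
    have "m - u + s *\<^sub>R (m + u - (m - u)) = m + (2 * s - 1) *\<^sub>R u" for s
      by (simp add: vec_eq_iff algebra_simps)
    then have "affine hull {m - u, m + u} = (\<lambda>s. m + s *\<^sub>R u) ` range (\<lambda>s. 2 * s - 1)"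
      by (simp only: affine_hull_2_alt image_image)
    also have "range (\<lambda>s::real. 2 * s - 1) = UNIV"
      by (rule surjI[of _ "\<lambda>s. (s + 1) / 2"]) (simp add: field_simps)
    finally show ?thesis .
  qed
  show "hyperbola_vertices (hyperbola m u a) \<subseteq> ?V m u a"
  proof
    fix V assume "V \<in> hyperbola_vertices (hyperbola m u a)"
    then obtain F F' where V: "V \<in> hyperbola m u a" "hyperbola_with_foci (hyperbola m u a) F F'"
      "V \<in> affine hull {F, F'}"
      unfolding hyperbola_vertices_def by blast
    obtain n w where F: "F = n - w" "F' = n + w" by (rule obtain_center)
    obtain b where b: "0 < b" "b < norm w" "hyperbola m u a = hyperbola n w b"
      using V(2) unfolding F hyperbola_with_foci_iff by blast
    obtain s where s: "V = n + s *\<^sub>R w" using V(3) unfolding F axis by blast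
    have "s\<^sup>2 * (w \<bullet> w) = b\<^sup>2"
      using V(1) hyperbola_axis_iff[OF b(1,2), of n s] unfolding b(3) s by blast
    then have "(norm (V - n))\<^sup>2 = b\<^sup>2"
      by (simp add: s power_mult_distrib power2_norm_eq_inner)
    then have "norm (V - n) = b" using b by (simp add: power2_eq_iff_nonneg)
    then have "V \<in> ?V n w b"
      using hyperbola_norm_eq_iff[OF b(1,2)] V(1) unfolding b(3) by blast
    then show "V \<in> ?V m u a"
      using hyperbola_same_vertices[OF assms b] by simp
  qed
  have "hyperbola_with_foci (hyperbola m u a) (m - u) (m + u)"
    using hyperbola_with_foci_iff assms by blast
  moreover have "?V m u a \<subseteq> affine hull {m - u, m + u}"
    unfolding axis by (auto intro: rangeI[of "\<lambda>s. m + s *\<^sub>R u" "a / norm u"]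
        range_eqI[where f = "\<lambda>s. m + s *\<^sub>R u" and x = "- (a / norm u)"])
  ultimately show "?V m u a \<subseteq> hyperbola_vertices (hyperbola m u a)"
    using hyperbola_vertex[OF assms] unfolding hyperbola_vertices_def by blast
qed

text \<open>The center is the midpoint of the vertices, the focus then gives \<open>u\<close>, and
  half the distance of the vertices is \<open>a\<close>. This supplies uniqueness both for the Yff
  hyperbola and for the directrix.\<close>

lemma hyperbola_determined_by_vertices_focus:
  assumes ua: "0 < a" "a < norm u" and ua': "0 < a'" "a' < norm u'"
    and vert: "hyperbola_vertices (hyperbola m u a) = hyperbola_vertices (hyperbola m' u' a')"
    and focus: "m - u = m' - u'"
  shows "m = m'" "u = u'" "a = a'"
proof -
  define v v' where "v = (a / norm u) *\<^sub>R u" and "v' = (a' / norm u') *\<^sub>R u'"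
  have "{m - v, m + v} = {m' - v', m' + v'}"
    using vert unfolding hyperbola_vertices_hyperbola[OF ua] hyperbola_vertices_hyperbola[OF ua'] v_def v'_def .
  then consider "m - v = m' - v'" "m + v = m' + v'" | "m - v = m' + v'" "m + v = m' - v'"
    unfolding doubleton_eq_iff by blast
  then have "(m - v) + (m + v) = (m' - v') + (m' + v')"
    by cases (simp_all only: add.commute)
  then have "2 *\<^sub>R m = 2 *\<^sub>R m'" by (simp add: scaleR_2)
  then show m: "m = m'" by simp
  then show "u = u'" using focus by simp
  have "v = v' \<or> v = - v'"
    using \<open>{m - v, m + v} = {m' - v', m' + v'}\<close> m by (auto simp: doubleton_eq_iff)
  then have "norm v = norm v'" by auto
  then show "a = a'" using ua ua' by (auto simp: v_def v'_def split: if_splits)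
qed

section \<open>Lines in the plane and the distance to them\<close>

lemma plane_orthogonal_parallel:
  fixes n d x :: "real ^ 2"
  assumes "n \<noteq> 0" "d \<noteq> 0" "n \<bullet> d = 0" "n \<bullet> x = 0"
  shows "\<exists>s. x = s *\<^sub>R d"
proof -
  have nd: "n $ 1 * d $ 1 + n $ 2 * d $ 2 = 0" and nx: "n $ 1 * x $ 1 + n $ 2 * x $ 2 = 0"
    using assms(3,4) by (simp_all add: inner_vec_def sum_2)
  have "n $ 1 * (d $ 1 * x $ 2 - d $ 2 * x $ 1) = 0" "n $ 2 * (d $ 1 * x $ 2 - d $ 2 * x $ 1) = 0"
    using nd nx by algebra+
  moreover have "n $ 1 \<noteq> 0 \<or> n $ 2 \<noteq> 0"
    using assms(1) by (auto simp: vec_eq_iff forall_2)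
  ultimately have det: "d $ 1 * x $ 2 - d $ 2 * x $ 1 = 0" by auto
  \<comment> \<open>Coordinatewise, the two sides differ by a multiple of the vanishing determinant
    of \<open>d\<close> and \<open>x\<close>.\<close>
  have "(d \<bullet> d) *\<^sub>R x = (x \<bullet> d) *\<^sub>R d"
    using det by (simp add: vec_eq_iff forall_2 inner_vec_def sum_2) algebra
  then have "x = ((x \<bullet> d) / (d \<bullet> d)) *\<^sub>R d"
    using assms(2) by (metis (no_types, lifting) divide_inverse_commute inner_eq_zero_iff
        left_inverse scaleR_one scaleR_scaleR)
  then show ?thesis by blast
qed

lemma plane_obtain_orthogonal:
  fixes d :: "real ^ 2"
  assumes "d \<noteq> 0"
  obtains n :: "real ^ 2" where "n \<noteq> 0" "n \<bullet> d = 0"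
proof
  show "vector [- (d $ 2), d $ 1] \<noteq> (0 :: real ^ 2)"
    using assms by (auto simp: vec_eq_iff forall_2)
  show "vector [- (d $ 2), d $ 1] \<bullet> d = 0"
    by (simp add: inner_vec_def sum_2)
qed

lemma affine_hull_eq_hyperplane:
  fixes n :: "real ^ 2"
  assumes "n \<noteq> 0" "P \<noteq> Q" "n \<bullet> (Q - P) = 0"
  shows "affine hull {P, Q} = {X. n \<bullet> X = n \<bullet> P}"
proof (intro set_eqI iffI)
  fix X assume "X \<in> affine hull {P, Q}"
  then show "X \<in> {X. n \<bullet> X = n \<bullet> P}"
    using assms(3) by (auto simp: affine_hull_2_alt inner_add_right)
next
  fix X assume "X \<in> {X. n \<bullet> X = n \<bullet> P}"
  then have "n \<bullet> (X - P) = 0" by (simp add: inner_diff_right)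
  then obtain s where "X - P = s *\<^sub>R (Q - P)"
    using plane_orthogonal_parallel[of n "Q - P" "X - P"] assms by auto
  then have "X = P + s *\<^sub>R (Q - P)" by (simp add: algebra_simps)
  then show "X \<in> affine hull {P, Q}" by (auto simp: affine_hull_2_alt)
qed

lemma is_line_iff: "is_line L \<longleftrightarrow> (\<exists>n d. n \<noteq> 0 \<and> L = {X. n \<bullet> X = d})"
proof
  assume "is_line L"
  then obtain P Q where PQ: "P \<noteq> Q" "L = affine hull {P, Q}" unfolding is_line_def by blast
  obtain n where "n \<noteq> 0" "n \<bullet> (Q - P) = 0"
    using plane_obtain_orthogonal[of "Q - P"] PQ(1) by auto
  then show "\<exists>n d. n \<noteq> 0 \<and> L = {X. n \<bullet> X = d}"
    using affine_hull_eq_hyperplane PQ by blast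
next
  assume "\<exists>n d. n \<noteq> 0 \<and> L = {X. n \<bullet> X = d}"
  then obtain n d where n: "n \<noteq> 0" and L: "L = {X. n \<bullet> X = d}" by blast
  obtain w where w: "w \<noteq> 0" "w \<bullet> n = 0" using plane_obtain_orthogonal[OF n] .
  \<comment> \<open>The foot of the perpendicular from the origin.\<close>
  define P where "P = (d / (n \<bullet> n)) *\<^sub>R n"
  have "n \<bullet> P = d" using n by (simp add: P_def)
  then have "L = affine hull {P, P + w}"
    using affine_hull_eq_hyperplane[of n P "P + w"] n w L by (simp add: inner_commute)
  then show "is_line L" unfolding is_line_def using w(1) by (metis add_cancel_right_right)
qed

text \<open>The foot \<open>Q\<close> of the perpendicular gives the upper bound; Cauchy-Schwarz at
  a nearest point \<open>R\<close> gives the lower one.\<close>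

lemma infdist_hyperplane:
  fixes n :: "'a::euclidean_space"
  assumes "n \<noteq> 0"
  shows "infdist P {X. n \<bullet> X = d} = \<bar>n \<bullet> P - d\<bar> / norm n"
proof (rule antisym)
  define Q where "Q = P - ((n \<bullet> P - d) / (n \<bullet> n)) *\<^sub>R n"
  have Q: "n \<bullet> Q = d" using assms by (simp add: Q_def inner_diff_right)
  have "dist P Q = \<bar>n \<bullet> P - d\<bar> / norm n"
    using assms by (simp add: Q_def dist_norm power2_norm_eq_inner[symmetric] power2_eq_square)
  then show "infdist P {X. n \<bullet> X = d} \<le> \<bar>n \<bullet> P - d\<bar> / norm n"
    using infdist_le[of Q "{X. n \<bullet> X = d}" P] Q by simp
  obtain R where R: "R \<in> {X. n \<bullet> X = d}" "infdist P {X. n \<bullet> X = d} = dist P R"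
    using infdist_attains_inf[of "{X. n \<bullet> X = d}" P] Q closed_hyperplane by blast
  then have "\<bar>n \<bullet> P - d\<bar> = \<bar>n \<bullet> (P - R)\<bar>" by (simp add: inner_diff_right)
  also have "\<dots> \<le> norm n * dist P R"
    unfolding dist_norm by (rule Cauchy_Schwarz_ineq2)
  finally show "\<bar>n \<bullet> P - d\<bar> / norm n \<le> infdist P {X. n \<bullet> X = d}"
    using assms R by (simp add: field_simps)
qed

section \<open>Focus and directrix\<close>

text \<open>By the distance formula the condition is
  \<open>a * norm (x + u) = \<bar>x \<bullet> u + a\<^sup>2\<bar>\<close> with
  \<open>x = P - m\<close>. On squaring, the terms linear in \<open>x\<close> cancel and the
  equation of the hyperbola remains, for both branches at once.\<close>

lemma hyperbola_focus_directrix: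
  fixes u :: "'a::euclidean_space"
  assumes "0 < a" "a < norm u"
  shows "hyperbola m u a =
    {P. dist P (m - u) = (norm u / a) * infdist P {X. u \<bullet> (X - m) = - a\<^sup>2}}"
proof -
  have u: "u \<noteq> 0" using assms by auto
  have "P \<in> hyperbola m u a \<longleftrightarrow>
      dist P (m - u) = (norm u / a) * infdist P {X. u \<bullet> (X - m) = - a\<^sup>2}" for P
  proof -
    define x where "x = P - m"
    have "{X. u \<bullet> (X - m) = - a\<^sup>2} = {X. u \<bullet> X = u \<bullet> m - a\<^sup>2}"
      by (auto simp: inner_diff_right)
    then have "infdist P {X. u \<bullet> (X - m) = - a\<^sup>2} = \<bar>x \<bullet> u + a\<^sup>2\<bar> / norm u"
      by (simp only: infdist_hyperplane[OF u]) (simp add: x_def inner_simps inner_commute diff_diff_eq2 diff_add_eq)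
    moreover have "dist P (m - u) = norm (x + u)" by (simp add: x_def dist_norm algebra_simps)
    ultimately have "dist P (m - u) = (norm u / a) * infdist P {X. u \<bullet> (X - m) = - a\<^sup>2} \<longleftrightarrow>
        a * norm (x + u) = \<bar>x \<bullet> u + a\<^sup>2\<bar>"
      using u assms by (simp add: field_simps)
    also have "\<dots> \<longleftrightarrow> (a * norm (x + u))\<^sup>2 = (x \<bullet> u + a\<^sup>2)\<^sup>2"
      using power2_eq_iff_nonneg[of "a * norm (x + u)" "\<bar>x \<bullet> u + a\<^sup>2\<bar>"] assms by simp
    also have "(a * norm (x + u))\<^sup>2 = a\<^sup>2 * (x \<bullet> x + 2 * (x \<bullet> u) + u \<bullet> u)"
      by (simp add: power_mult_distrib power2_norm_eq_inner inner_simps inner_commute)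
    also have "\<dots> = (x \<bullet> u + a\<^sup>2)\<^sup>2 \<longleftrightarrow>
        (x \<bullet> u)\<^sup>2 - a\<^sup>2 * (x \<bullet> x) = a\<^sup>2 * (u \<bullet> u - a\<^sup>2)"
      by (auto simp: power2_eq_square algebra_simps)
    finally show ?thesis unfolding mem_hyperbola_iff[OF assms] x_def by simp
  qed
  then show ?thesis by blast
qed

text \<open>With \<open>n\<close> the normal of the directrix and \<open>k\<close> the signed distance of the focus times \<open>norm n\<close>,
  solve \<open>norm u = e * a\<close> and \<open>a\<^sup>2 = (norm u)\<^sup>2 - s * k\<close> for \<open>u = s *\<^sub>R n\<close>.\<close>

lemma directrix_obtain_hyperbola:
  fixes n F :: "'a::euclidean_space"
  assumes "n \<noteq> 0" "n \<bullet> F \<noteq> d" "1 < e"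
  obtains m u :: 'a and a where "0 < a" "a < norm u" "F = m - u" "norm u / a = e"
    "{X. n \<bullet> X = d} = {X. u \<bullet> (X - m) = - a\<^sup>2}"
proof
  define k s a where "k = d - n \<bullet> F" and "s = e\<^sup>2 * k / ((n \<bullet> n) * (e\<^sup>2 - 1))"
    and "a = e * \<bar>k\<bar> / (norm n * (e\<^sup>2 - 1))"
  have e: "0 < e\<^sup>2 - 1" using assms(3) by (simp add: one_less_power)
  have k: "k \<noteq> 0" using assms(2) by (simp add: k_def)
  show a: "0 < a" using assms e k by (simp add: a_def)
  have norm: "norm (s *\<^sub>R n) = e * a"
    using assms e by (simp add: s_def a_def abs_mult power2_norm_eq_inner[symmetric] power2_eq_square)
  show "a < norm (s *\<^sub>R n)" unfolding norm using a assms(3) by simp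
  show "norm (s *\<^sub>R n) / a = e" unfolding norm using a by simp
  show "F = (F + s *\<^sub>R n) - s *\<^sub>R n" by simp
  have s: "s \<noteq> 0" using k assms by (simp add: s_def power2_eq_1_iff)
  have "s * k = e\<^sup>2 * k\<^sup>2 / ((norm n)\<^sup>2 * (e\<^sup>2 - 1))"
    unfolding s_def power2_norm_eq_inner by (simp add: power2_eq_square[of k] mult.assoc)
  also have "\<dots> = a\<^sup>2 * (e\<^sup>2 - 1)"
    using e assms by (simp add: a_def power_divide power_mult_distrib power2_eq_square[of "e\<^sup>2 - 1"])
  also have "\<dots> = (norm (s *\<^sub>R n))\<^sup>2 - a\<^sup>2"
    unfolding norm by (simp add: power_mult_distrib algebra_simps)
  finally have sk: "s * k = s * s * (n \<bullet> n) - a\<^sup>2"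
    by (simp only: power2_norm_eq_inner inner_scaleR_left inner_scaleR_right mult.assoc)
  \<comment> \<open>Combined with \<open>sk\<close>, this turns the directrix equation for
    \<open>u = s *\<^sub>R n\<close> into \<open>s\<close> times the equation of the given
    line.\<close>
  have expand: "s *\<^sub>R n \<bullet> (X - (F + s *\<^sub>R n)) = s * (n \<bullet> X) - s * (n \<bullet> F) - s * s * (n \<bullet> n)" for X
    by (simp add: inner_simps algebra_simps)
  have "s * k = s * d - s * (n \<bullet> F)" by (simp add: k_def algebra_simps)
  then have "s *\<^sub>R n \<bullet> (X - (F + s *\<^sub>R n)) = - a\<^sup>2 \<longleftrightarrow> s * (n \<bullet> X) = s * d" for X
    unfolding expand using sk by argo
  then show "{X. n \<bullet> X = d} = {X. s *\<^sub>R n \<bullet> (X - (F + s *\<^sub>R n)) = - a\<^sup>2}"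
    using s by simp
qed

text \<open>For uniqueness, a directrix \<open>D\<close> with its \<open>e\<close> is first turned
  into parameters \<open>m'\<close>, \<open>u'\<close>, \<open>a'\<close> of the same point set with
  the same focus. These must equal \<open>m\<close>, \<open>u\<close>, \<open>a\<close>, and they
  determine \<open>D\<close>.\<close>

lemma is_directrix_hyperbola_iff:
  assumes "0 < a" "a < norm u"
  shows "is_directrix (hyperbola m u a) (m - u) D \<longleftrightarrow> D = {X. u \<bullet> (X - m) = - a\<^sup>2}"
proof
  assume "is_directrix (hyperbola m u a) (m - u) D"
  then obtain e where D: "is_line D" "m - u \<notin> D" "1 < e"
    "hyperbola m u a = {P. dist P (m - u) = e * infdist P D}"
    unfolding is_directrix_def by blast
  then obtain n d where n: "n \<noteq> 0" "D = {X. n \<bullet> X = d}" unfolding is_line_iff by blast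
  then have "n \<bullet> (m - u) \<noteq> d" using D(2) by blast
  from directrix_obtain_hyperbola[OF n(1) this D(3)] obtain m' u' a'
    where *: "0 < a'" "a' < norm u'" "m - u = m' - u'" "norm u' / a' = e"
      "D = {X. u' \<bullet> (X - m') = - a'\<^sup>2}"
    unfolding n(2) by metis
  have "hyperbola m u a = hyperbola m' u' a'"
    unfolding D(4) hyperbola_focus_directrix[OF *(1,2)] *(3-5) ..
  then show "D = {X. u \<bullet> (X - m) = - a\<^sup>2}"
    using hyperbola_determined_by_vertices_focus[OF assms *(1,2) _ *(3)] *(5) by simp
next
  assume D: "D = {X. u \<bullet> (X - m) = - a\<^sup>2}"
  have u: "u \<noteq> 0" using assms by auto
  have "D = {X. u \<bullet> X = u \<bullet> m - a\<^sup>2}" unfolding D by (auto simp: inner_diff_right)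
  then have "is_line D" unfolding is_line_iff using u by blast
  moreover have "m - u \<notin> D" unfolding D using norm_less_imp_square_less[OF assms] by simp
  moreover have "1 < norm u / a" using assms by simp
  ultimately show "is_directrix (hyperbola m u a) (m - u) D"
    unfolding is_directrix_def using hyperbola_focus_directrix[OF assms] D by blast
qed

section \<open>Circumcenter, orthocenter and Euler's relation\<close>

text \<open>A nonzero \<open>x\<close> would be a normal of the line AB, and \<open>C\<close> would
  lie on that line. Uniqueness of both triangle centers rests on this.\<close>

lemma noncollinear_orthogonal_zero:
  fixes A B C x :: "real ^ 2"
  assumes "\<not> collinear {A, B, C}" "x \<bullet> (B - A) = 0" "x \<bullet> (C - A) = 0"
  shows "x = 0"
proof (rule ccontr)
  assume "x \<noteq> 0"
  have "A \<noteq> B" using assms(1) by auto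
  then have "C \<in> affine hull {A, B}"
    unfolding affine_hull_eq_hyperplane[OF \<open>x \<noteq> 0\<close> \<open>A \<noteq> B\<close> assms(2)]
    using assms(3) by (simp add: inner_diff_right)
  then show False using assms(1) \<open>A \<noteq> B\<close> collinear_3_affine_hull by blast
qed

text \<open>The terms \<open>P \<bullet> P\<close> cancel, so equidistance is a linear condition on
  \<open>P\<close>.\<close>

lemma dist_eq_iff_inner:
  fixes P :: "'a::real_inner"
  shows "dist P A = dist P B \<longleftrightarrow> P \<bullet> (B - A) = (B \<bullet> B - A \<bullet> A) / 2"
proof -
  have "dist P A = dist P B \<longleftrightarrow> (dist P A)\<^sup>2 = (dist P B)\<^sup>2"
    by (simp add: power2_eq_iff_nonneg)
  also have "\<dots> \<longleftrightarrow> P \<bullet> (B - A) = (B \<bullet> B - A \<bullet> A) / 2"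
    unfolding dist_norm power2_norm_eq_inner by (auto simp: inner_simps inner_commute field_simps)
  finally show ?thesis .
qed

lemma circumcenter_eqI:
  assumes "\<not> collinear {A, B, C}" "dist P A = dist P B" "dist P B = dist P C"
  shows "circumcenter (A, B, C) = P"
  unfolding circumcenter.simps
proof (rule the_equality)
  fix Q assume "dist Q A = dist Q B \<and> dist Q B = dist Q C"
  then have "dist Q A = dist Q B" "dist Q A = dist Q C" "dist P A = dist P C" using assms by auto
  then have "(Q - P) \<bullet> (B - A) = 0" "(Q - P) \<bullet> (C - A) = 0"
    using assms(2) unfolding dist_eq_iff_inner by (simp_all add: inner_diff_left)
  then show "Q = P" using noncollinear_orthogonal_zero[OF assms(1)] by force
qed (use assms in simp)

text \<open>Existence: the linear map \<open>f\<close> collects the left sides of the two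
  equidistance conditions; it is injective on the plane, hence surjective.\<close>

lemma circumcenter_equidistant:
  assumes "\<not> collinear {A, B, C}"
  shows "dist (circumcenter (A, B, C)) A = dist (circumcenter (A, B, C)) B"
    and "dist (circumcenter (A, B, C)) B = dist (circumcenter (A, B, C)) C"
proof -
  define f :: "real ^ 2 \<Rightarrow> real ^ 2" where "f P = vector [P \<bullet> (B - A), P \<bullet> (C - A)]" for P
  have lin: "linear f"
    by (rule linearI) (simp_all add: f_def vec_eq_iff forall_2 inner_add_left)
  have "P = 0" if "f P = 0" for P
    using that noncollinear_orthogonal_zero[OF assms] by (simp add: f_def vec_eq_iff forall_2)
  then have "inj f" using lin linear_injective_0 by blast
  then have "surj f" using lin linear_injective_imp_surjective by blast
  then obtain P where "f P = vector [(B \<bullet> B - A \<bullet> A) / 2, (C \<bullet> C - A \<bullet> A) / 2]"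
    by (metis surjD)
  then have "dist P A = dist P B" "dist P A = dist P C"
    unfolding dist_eq_iff_inner f_def by (simp_all add: vec_eq_iff forall_2)
  moreover from this have "circumcenter (A, B, C) = P" using circumcenter_eqI[OF assms] by simp
  ultimately show "dist (circumcenter (A, B, C)) A = dist (circumcenter (A, B, C)) B"
    "dist (circumcenter (A, B, C)) B = dist (circumcenter (A, B, C)) C" by simp_all
qed

lemma orthocenter_eqI:
  assumes "\<not> collinear {A, B, C}"
    and "orthogonal (P - A) (B - C)" "orthogonal (P - B) (C - A)" "orthogonal (P - C) (A - B)"
  shows "orthocenter (A, B, C) = P"
  unfolding orthocenter.simps
proof (rule the_equality)
  fix Q assume "orthogonal (Q - A) (B - C) \<and> orthogonal (Q - B) (C - A) \<and> orthogonal (Q - C) (A - B)"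
  then have "(Q - P) \<bullet> (B - A) = 0" "(Q - P) \<bullet> (C - A) = 0"
    using assms by (auto simp: orthogonal_def inner_simps)
  then show "Q = P" using noncollinear_orthogonal_zero[OF assms(1)] by force
qed (use assms in simp)

lemma orthocenter_euler:
  assumes "nondegenerate T"
  shows "orthocenter T = 3 *\<^sub>R centroid T - 2 *\<^sub>R circumcenter T"
proof -
  obtain A B C where T: "T = (A, B, C)" by (metis prod.exhaust)
  define P where "P = circumcenter T"
  have nc: "\<not> collinear {A, B, C}" using assms by (simp add: T)
  have "dist P A = dist P B" "dist P B = dist P C" "dist P C = dist P A"
    using circumcenter_equidistant[OF nc] by (simp_all add: P_def T)
  then have "P \<bullet> (B - A) = (B \<bullet> B - A \<bullet> A) / 2" "P \<bullet> (C - B) = (C \<bullet> C - B \<bullet> B) / 2"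
    "P \<bullet> (A - C) = (A \<bullet> A - C \<bullet> C) / 2"
    unfolding dist_eq_iff_inner .
  \<comment> \<open>For instance \<open>(B + C - 2 *\<^sub>R P) \<bullet> (B - C)\<close> vanishes
    by the equidistance of \<open>P\<close> from \<open>B\<close> and \<open>C\<close>.\<close>
  then have "orthocenter T = A + B + C - 2 *\<^sub>R P"
    unfolding T by (intro orthocenter_eqI[OF nc]) (simp_all add: orthogonal_def inner_simps inner_commute)
  then show ?thesis by (simp add: T P_def)
qed

section \<open>Centers of the medial triangle\<close>

text \<open>The medial triangle has the side vectors of \<open>T\<close> scaled by -1/2, and
  collinearity depends on two side vectors only.\<close>

lemma nondegenerate_medial_triangle:
  assumes "nondegenerate T"
  shows "nondegenerate (medial_triangle T)"
proof -
  obtain A B C where T: "T = (A, B, C)" by (metis prod.exhaust)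
  have "midpoint B C - midpoint C A = (- (1/2)) *\<^sub>R (A - B)"
    "midpoint A B - midpoint C A = (- (1/2)) *\<^sub>R (C - B)"
    by (simp_all add: midpoint_def algebra_simps)
  then have "collinear {midpoint B C, midpoint C A, midpoint A B} \<longleftrightarrow>
      collinear {0, (- (1/2)) *\<^sub>R (A - B), (- (1/2)) *\<^sub>R (C - B)}"
    using collinear_3[of "midpoint B C" "midpoint C A" "midpoint A B"] by (simp only: NO_MATCH_def)
  also have "\<dots> \<longleftrightarrow> collinear {0, A - B, C - B}"
    unfolding collinear_scaleR_iff by simp
  also have "\<dots> \<longleftrightarrow> collinear {A, B, C}"
    using collinear_3[of A B C] by (simp only: NO_MATCH_def)
  finally show ?thesis using assms by (simp add: T)
qed

lemma centroid_medial_triangle: "centroid (medial_triangle T) = centroid T"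
  by (cases T) (auto simp: midpoint_def vec_eq_iff field_simps)

text \<open>The point \<open>N\<close> is the nine-point center, midway between circumcenter and
  orthocenter; its distance to the midpoint of each side is half the circumradius.\<close>

lemma circumcenter_medial_triangle:
  assumes "nondegenerate T"
  shows "circumcenter (medial_triangle T) = (1/2) *\<^sub>R (3 *\<^sub>R centroid T - circumcenter T)"
proof -
  obtain A B C where T: "T = (A, B, C)" by (metis prod.exhaust)
  define P where "P = circumcenter T"
  define N where "N = (1/2) *\<^sub>R (A + B + C - P)"
  have nc: "\<not> collinear {A, B, C}" using assms by (simp add: T)
  have "dist N (midpoint B C) = dist P A / 2" "dist N (midpoint C A) = dist P B / 2"
    "dist N (midpoint A B) = dist P C / 2"
  proof -
    have "N - midpoint B C = (1/2) *\<^sub>R (A - P)" "N - midpoint C A = (1/2) *\<^sub>R (B - P)"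
      "N - midpoint A B = (1/2) *\<^sub>R (C - P)"
      by (simp_all add: N_def midpoint_def algebra_simps)
    then show "dist N (midpoint B C) = dist P A / 2" "dist N (midpoint C A) = dist P B / 2"
      "dist N (midpoint A B) = dist P C / 2"
      by (simp_all add: dist_norm norm_minus_commute)
  qed
  moreover have "dist P A = dist P B" "dist P B = dist P C"
    using circumcenter_equidistant[OF nc] by (simp_all add: P_def T)
  ultimately have "circumcenter (medial_triangle T) = N"
    using nondegenerate_medial_triangle[OF assms] unfolding T
    by (simp only: medial_triangle.simps nondegenerate.simps) (intro circumcenter_eqI; simp)
  then show ?thesis by (simp add: N_def T P_def)
qed

lemma orthocenter_medial_triangle:
  assumes "nondegenerate T"
  shows "orthocenter (medial_triangle T) = circumcenter T"
  unfolding orthocenter_euler[OF nondegenerate_medial_triangle[OF assms]]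
    centroid_medial_triangle circumcenter_medial_triangle[OF assms] by simp

text \<open>Seen from the common center, the parallelogram law expresses each side through the three
  equal distances to the vertices. The contrapositive keeps \<open>u\<close> nonzero below.\<close>

lemma centroid_eq_circumcenter_imp_equilateral:
  assumes "nondegenerate T" "centroid T = circumcenter T"
  shows "equilateral T"
proof -
  obtain A B C where T: "T = (A, B, C)" by (metis prod.exhaust)
  define P where "P = circumcenter T"
  have nc: "\<not> collinear {A, B, C}" using assms by (simp add: T)
  have eq: "dist P A = dist P B" "dist P B = dist P C"
    using circumcenter_equidistant[OF nc] by (simp_all add: P_def T)
  have "(1/3) *\<^sub>R (A + B + C) = P" using assms(2) by (simp add: T P_def)
  then have "3 *\<^sub>R ((1/3) *\<^sub>R (A + B + C)) = 3 *\<^sub>R P" by (rule arg_cong)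
  then have sum: "A + B + C = 3 *\<^sub>R P" by simp
  have side: "(dist X Y)\<^sup>2 = 2 * (dist P X)\<^sup>2 + 2 * (dist P Y)\<^sup>2 - (dist P Z)\<^sup>2"
    if "X + Y + Z = 3 *\<^sub>R P" for X Y Z
  proof -
    have Z: "Z = 3 *\<^sub>R P - X - Y" using that by (simp add: algebra_simps)
    show ?thesis unfolding Z dist_norm power2_norm_eq_inner
      by (simp add: inner_simps inner_commute algebra_simps)
  qed
  have "(dist A B)\<^sup>2 = (dist B C)\<^sup>2" "(dist B C)\<^sup>2 = (dist C A)\<^sup>2"
    using side[of A B C] side[of B C A] side[of C A B] sum eq by (simp_all add: algebra_simps)
  then show ?thesis by (simp add: T power2_eq_iff_nonneg)
qed

section \<open>The Yff hyperbola and its relation to the medial triangle\<close>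

lemma yff_hyperbola_eq:
  fixes T :: triangle
  defines "u \<equiv> centroid T - circumcenter T"
  assumes "nondegenerate T" "\<not> equilateral T"
  shows "yff_hyperbola T = hyperbola (circumcenter T + 2 *\<^sub>R u) (2 *\<^sub>R u) (norm u)"
    and "hyperbola_vertices (yff_hyperbola T) = {centroid T, orthocenter T}"
    and "is_focus (yff_hyperbola T) (circumcenter T)"
proof -
  let ?m = "circumcenter T + 2 *\<^sub>R u"
  have "u \<noteq> 0" using centroid_eq_circumcenter_imp_equilateral assms by (metis right_minus_eq)
  then have ua: "0 < norm u" "norm u < norm (2 *\<^sub>R u)" by simp_all
  have "(norm u / norm (2 *\<^sub>R u)) *\<^sub>R (2 *\<^sub>R u) = u" using \<open>u \<noteq> 0\<close> by simp
  \<comment> \<open>The half focal vector is \<open>2 *\<^sub>R u\<close>, so the vertices lie at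
    \<open>u\<close> on either side of the center \<open>?m\<close>, and the focus
    \<open>?m - 2 *\<^sub>R u\<close> is the circumcenter.\<close>
  moreover have "?m - u = centroid T" "?m + u = orthocenter T"
    unfolding orthocenter_euler[OF assms(2)] by (simp_all add: u_def vec_eq_iff)
  ultimately have vert: "hyperbola_vertices (hyperbola ?m (2 *\<^sub>R u) (norm u)) = {centroid T, orthocenter T}"
    using hyperbola_vertices_hyperbola[OF ua, of ?m] by simp
  have focus: "is_focus (hyperbola ?m (2 *\<^sub>R u) (norm u)) (circumcenter T)"
    unfolding is_focus_iff using ua by (intro exI conjI) auto
  show eq: "yff_hyperbola T = hyperbola ?m (2 *\<^sub>R u) (norm u)"
    unfolding yff_hyperbola_def
  proof (rule the_equality)
    fix Y assume Y: "hyperbola_vertices Y = {centroid T, orthocenter T} \<and> is_focus Y (circumcenter T)"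
    then obtain m' u' a' where *: "0 < a'" "a' < norm u'" "circumcenter T = m' - u'" "Y = hyperbola m' u' a'"
      unfolding is_focus_iff by blast
    then show "Y = hyperbola ?m (2 *\<^sub>R u) (norm u)"
      using hyperbola_determined_by_vertices_focus[OF ua *(1,2), of ?m m'] vert Y by simp
  qed (use vert focus in simp)
  show "hyperbola_vertices (yff_hyperbola T) = {centroid T, orthocenter T}"
    "is_focus (yff_hyperbola T) (circumcenter T)"
    unfolding eq by (fact vert focus)+
qed

theorem theorem4:
  fixes T\<^sub>0 T :: triangle and Y :: "point set"
  assumes "nondegenerate T\<^sub>0"
    and "\<not> equilateral T\<^sub>0"
    and "T = medial_triangle T\<^sub>0"
    and "Y = yff_hyperbola T\<^sub>0"
  shows "hyperbola_vertices Y = {centroid T, de_longchamps_point T} \<and>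
         is_focus Y (orthocenter T) \<and>
         (\<exists>!D. is_directrix Y (orthocenter T) D) \<and>
         (\<forall>D. is_directrix Y (orthocenter T) D \<longrightarrow>
            perpendicular D (euler_line T) \<and> circumcenter T \<in> D)"
proof -
  define P u where "P = circumcenter T\<^sub>0" and "u = centroid T\<^sub>0 - P"
  note Y = yff_hyperbola_eq[OF assms(1,2), folded assms(4) P_def, folded u_def]
  have u: "u \<noteq> 0" using centroid_eq_circumcenter_imp_equilateral assms(1,2)
    unfolding u_def P_def by (metis right_minus_eq)
  have orth: "orthocenter T = P"
    using orthocenter_medial_triangle[OF assms(1)] by (simp add: assms(3) P_def)
  have circ: "circumcenter T = P + (3/2) *\<^sub>R u"
    unfolding assms(3) circumcenter_medial_triangle[OF assms(1)]
    by (simp add: P_def u_def vec_eq_iff field_simps)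
  have cen: "centroid T = centroid T\<^sub>0" using centroid_medial_triangle by (simp add: assms(3))
  \<comment> \<open>Reflecting \<open>P\<close> in P + (3/2)u gives P + 3u, the orthocenter of the
    original triangle.\<close>
  have longchamps: "de_longchamps_point T = orthocenter T\<^sub>0"
    unfolding de_longchamps_point_def orth circ orthocenter_euler[OF assms(1)] P_def[symmetric]
    by (simp add: u_def vec_eq_iff field_simps)
  \<comment> \<open>The directrix equation for half focal vector \<open>2 *\<^sub>R u\<close>,
    center \<open>P + 2 *\<^sub>R u\<close> and semi-axis \<open>norm u\<close>.\<close>
  define L where "L = {X. (2 *\<^sub>R u) \<bullet> (X - (P + 2 *\<^sub>R u)) = - (norm u)\<^sup>2}"
  have directrix: "is_directrix Y P D \<longleftrightarrow> D = L" for D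
    using is_directrix_hyperbola_iff[of "norm u" "2 *\<^sub>R u" "P + 2 *\<^sub>R u" D] u
    unfolding Y(1) L_def by simp
  have euler: "euler_line T = range (\<lambda>s. P + s *\<^sub>R u)"
  proof -
    \<comment> \<open>An affine change of parameter moves the origin of the Euler line to
      \<open>P\<close> and its direction to \<open>u\<close>.\<close>
    have "P + (3/2) *\<^sub>R u + s *\<^sub>R (P - (P + (3/2) *\<^sub>R u)) = P + (3/2 - s * (3/2)) *\<^sub>R u" for s
      by (simp add: scaleR_left_diff_distrib)
    then have "euler_line T = (\<lambda>s. P + s *\<^sub>R u) ` range (\<lambda>s. 3/2 - s * (3/2))"
      by (simp only: euler_line_def orth circ affine_hull_2_alt image_image)
    also have "range (\<lambda>s::real. 3/2 - s * (3/2)) = UNIV"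
      by (rule surjI[of _ "\<lambda>s. 1 - (2/3) * s"]) (simp add: field_simps)
    finally show ?thesis .
  qed
  have "is_line (euler_line T)"
    unfolding is_line_def euler_line_def orth circ using u by (metis add_cancel_right_right scaleR_eq_0_iff
        zero_neq_numeral divide_eq_0_iff)
  moreover have "is_line L" using directrix is_directrix_def by blast
  moreover have "orthogonal (A - B) (C - D)" if "A \<in> L" "B \<in> L" "C \<in> euler_line T" "D \<in> euler_line T" for A B C D
  proof -
    obtain s t where "C = P + s *\<^sub>R u" "D = P + t *\<^sub>R u" using \<open>C \<in> _\<close> \<open>D \<in> _\<close> unfolding euler by blast
    then have "C - D = (s - t) *\<^sub>R u" by (simp add: algebra_simps)
    moreover have "u \<bullet> (A - B) = 0" using \<open>A \<in> L\<close> \<open>B \<in> L\<close> by (simp add: L_def inner_diff_right)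
    ultimately show ?thesis by (simp add: orthogonal_def inner_commute)
  qed
  ultimately have "perpendicular L (euler_line T)" unfolding perpendicular_def by blast
  \<comment> \<open>The circumcenter is the center of the hyperbola minus u/2, and the inner product
    of 2u with -u/2 is \<open>- (norm u)\<^sup>2\<close>.\<close>
  moreover have "circumcenter T \<in> L"
    unfolding L_def circ by (simp add: inner_simps power2_norm_eq_inner)
  ultimately show ?thesis using Y(2,3) directrix by (simp add: orth cen longchamps P_def[symmetric])
qed

end
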